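(* Let $n$ and $k$ be integers with $1\le k<n/2$ and suppose that the generalized Petersen graph $G(n,k)$ has order greater than $80$ (that is, $2n>80$). Let $\mathcal{P}$ be the partition of the edge set of $G(n,k)$ in which two edges $e,e'$ belong to the same part if and only if $\sigma(e)=\sigma(e')$, where $\sigma(e)$ denotes the number of $8$-cycles of $G(n,k)$ containing the edge $e$. Then $\mathcal{P}$ contains a part of size exactly $n$.
   Context: For integers $n\ge 3$ and $1\le k<n/2$, the generalized Petersen graph $G(n,k)$ is the cubic graph with vertex set $\{u_0,\dots,u_{n-1},w_0,\dots,w_{n-1}\}$ and edge set $\{u_iu_{i+1}\}\cup\{u_iw_i\}\cup\{w_iw_{i+k}\}$ for $i=0,1,\dots,n-1$, all subscripts taken modulo $n$. An $8$-cycle is a subgraph that is a cycle of length $8$ (not necessarily induced); $8$-cycles are counted as subgraphs. *)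

theory Defs
  imports Main
begin

text \<open>A graph is a pair of a vertex set and a set of edges, each edge being the set of its
  two endpoints.\<close>

type_synonym 'a graph = "'a set \<times> 'a set set"

abbreviation verts :: "'a graph \<Rightarrow> 'a set" where
  "verts G \<equiv> fst G"

abbreviation edges :: "'a graph \<Rightarrow> 'a set set" where
  "edges G \<equiv> snd G"

definition subgraph :: "'a graph \<Rightarrow> 'a graph \<Rightarrow> bool" where
  "subgraph H G \<longleftrightarrow> verts H \<subseteq> verts G \<and> edges H \<subseteq> edges G"

definition cycle_graph :: "nat \<Rightarrow> 'a graph \<Rightarrow> bool" where
  "cycle_graph m C \<longleftrightarrow> m \<ge> 3 \<and>
     (\<exists>c :: nat \<Rightarrow> 'a. inj_on c {..<m} \<and> verts C = c ` {..<m} \<and>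
        edges C = {{c i, c (Suc i mod m)} | i. i < m})"

text \<open>Cycles are collected as subgraphs, so the starting point and the orientation of a
  traversal are irrelevant, and chords are allowed.\<close>

definition cycles :: "nat \<Rightarrow> 'a graph \<Rightarrow> 'a graph set" where
  "cycles m G = {C. cycle_graph m C \<and> subgraph C G}"

definition sigma :: "'a graph \<Rightarrow> 'a set \<Rightarrow> nat" where
  "sigma G e = card {C \<in> cycles 8 G. e \<in> edges C}"

definition edge_partition :: "'a graph \<Rightarrow> 'a set set set" where
  "edge_partition G =
     edges G // {(e, e'). e \<in> edges G \<and> e' \<in> edges G \<and> sigma G e = sigma G e'}"

datatype gp_vertex = U nat | W nat

definition gen_petersen :: "nat \<Rightarrow> nat \<Rightarrow> gp_vertex graph" where
  "gen_petersen n k =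
     (U ` {..<n} \<union> W ` {..<n},
      {{U i, U ((i + 1) mod n)} | i. i < n} \<union>
      {{U i, W i} | i. i < n} \<union>
      {{W i, W ((i + k) mod n)} | i. i < n})"

end

theory Submission
  imports Defs
begin

text \<open>Rotation by one position is an automorphism of \<open>G(n,k)\<close>, so \<open>\<sigma>\<close> is constant on the
  outer rim, on the inner rim and on the spokes, each of which has \<open>n\<close> edges. If the three values
  are not all equal, one of them differs from both others, and the corresponding orbit is a
  part of size \<open>n\<close>. It therefore suffices that the three values do not coincide
  (lemma \<open>sigma_not_constant\<close>).

  By double counting, \<open>n\<close> times the value of \<open>\<sigma>\<close> on an orbit is the total number of edges that the
  8-cycles have in this orbit. Write the type of an 8-cycle as (outer, spoke, inner) edge counts.
  Following a cycle in the universal cover of the two rims, where positions are integers, turns it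
  into a word of eight steps, and a short case analysis leaves three kinds (lemma
  \<open>cycle_types\<close>): type \<open>(0,0,8)\<close>, which forces \<open>n dvd 8k\<close>; type
  \<open>(a,2,6-a)\<close> with \<open>1 \<le> a \<le> 5\<close>, which forces \<open>n dvd \<plusminus>a \<plusminus> (6-a)k\<close>; and type \<open>(2,4,2)\<close>.

  Two relations \<open>n dvd \<plusminus>a \<plusminus> bk\<close> and \<open>n dvd \<plusminus>c \<plusminus> dk\<close> imply that \<open>n\<close> divides
  \<open>\<plusminus>ad \<plusminus> bc\<close>. For the pairs \<open>(a,b)\<close> above this number is at most \<open>5 * 8 = 40 < n\<close> in absolute
  value, so it vanishes and the pairs are proportional. This is where the bound on the order
  enters. Consequently all 8-cycles with different numbers of outer and inner edges
  are biased to the same side (lemma \<open>same_bias\<close>), and if even one such cycle exists, the outer and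
  the inner totals differ.

  Otherwise only the types \<open>(3,2,3)\<close> and \<open>(2,4,2)\<close> occur, and outer and spoke totals are compared.
  For \<open>k = 1\<close> only the first type exists, so there are more outer edges. For \<open>k > 1\<close> there are at
  least \<open>n\<close> cycles of type \<open>(2,4,2)\<close>, each with two more spokes than outer edges, and at most \<open>n\<close>
  cycles of type \<open>(3,2,3)\<close>, each with one more outer edge than spokes, so there are more spokes.\<close>

section \<open>Counting 8-cycles through edges\<close>

lemma finite_cycles:
  assumes fin: "finite (verts G)" and wf: "edges G \<subseteq> Pow (verts G)"
  shows "finite (cycles m G)"
proof -
  have "cycles m G \<subseteq> Pow (verts G) \<times> Pow (edges G)"
    by (auto simp: cycles_def subgraph_def)
  moreover have "finite (edges G)" using wf fin by (meson finite_Pow_iff finite_subset)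
  ultimately show ?thesis using fin by (meson finite_Pow_iff finite_SigmaI finite_subset)
qed

text \<open>An injective endomorphism carries the 8-cycles through \<open>e\<close> injectively to 8-cycles through
  \<open>f ` e\<close>. Applied to a rotation and to its inverse, this gives invariance of \<open>\<sigma>\<close>.\<close>

lemma sigma_le_image:
  assumes fin: "finite (verts G)" and wf: "edges G \<subseteq> Pow (verts G)"
    and inj: "inj_on f (verts G)" and V: "f ` verts G \<subseteq> verts G"
    and E: "\<And>e. e \<in> edges G \<Longrightarrow> f ` e \<in> edges G"
  shows "sigma G e \<le> sigma G (f ` e)"
proof -
  define M where "M = (\<lambda>C :: 'a graph. (f ` verts C, (`) f ` edges C))"
  have injE: "inj_on ((`) f) (edges G)"
    using inj wf by (meson inj_on_image_Pow inj_on_subset)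
  have "inj_on M (cycles 8 G)"
  proof (rule inj_onI)
    fix C D assume C: "C \<in> cycles 8 G" and D: "D \<in> cycles 8 G" and "M C = M D"
    then have "f ` verts C = f ` verts D" "(`) f ` edges C = (`) f ` edges D"
      by (auto simp: M_def)
    moreover have "verts C \<subseteq> verts G" "verts D \<subseteq> verts G" "edges C \<subseteq> edges G" "edges D \<subseteq> edges G"
      using C D by (auto simp: cycles_def subgraph_def)
    ultimately have "verts C = verts D" "edges C = edges D"
      using inj injE by (auto simp: inj_on_image_eq_iff)
    then show "C = D" by (simp add: prod_eq_iff)
  qed
  then have "inj_on M {C \<in> cycles 8 G. e \<in> edges C}" by (rule inj_on_subset) auto
  moreover have "M ` {C \<in> cycles 8 G. e \<in> edges C} \<subseteq> {C \<in> cycles 8 G. f ` e \<in> edges C}"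
  proof
    fix D assume "D \<in> M ` {C \<in> cycles 8 G. e \<in> edges C}"
    then obtain C where C: "C \<in> cycles 8 G" "e \<in> edges C" and D: "D = M C" by auto
    from C obtain c where c: "inj_on c {..<8}" "verts C = c ` {..<8::nat}"
      "edges C = {{c i, c (Suc i mod 8)} | i. i < 8}" and sub: "verts C \<subseteq> verts G" "edges C \<subseteq> edges G"
      by (auto simp: cycles_def cycle_graph_def subgraph_def)
    have "inj_on (f \<circ> c) {..<8}" using c inj sub by (metis comp_inj_on inj_on_subset)
    moreover have "verts D = (f \<circ> c) ` {..<8}" by (auto simp: D M_def c)
    moreover have "edges D = {{(f \<circ> c) i, (f \<circ> c) (Suc i mod 8)} | i. i < 8}"
      by (simp add: D M_def c setcompr_eq_image image_image)
    ultimately have "cycle_graph 8 D" unfolding cycle_graph_def by (intro conjI exI[of _ "f \<circ> c"]) auto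
    moreover have "subgraph D G" using sub V E by (fastforce simp: subgraph_def D M_def)
    ultimately show "D \<in> {C \<in> cycles 8 G. f ` e \<in> edges C}"
      using C by (auto simp: cycles_def D M_def)
  qed
  ultimately show ?thesis unfolding sigma_def using finite_cycles[OF fin wf] by (intro card_inj_on_le[of M]) auto
qed

lemma sum_sigma:
  assumes "finite (cycles 8 G)" "finite F"
  shows "(\<Sum>e\<in>F. sigma G e) = (\<Sum>C\<in>cycles 8 G. card (edges C \<inter> F))"
proof -
  have "(\<Sum>e\<in>F. sigma G e) = (\<Sum>e\<in>F. \<Sum>C\<in>cycles 8 G. if e \<in> edges C then 1 else 0)"
    unfolding sigma_def using assms by (simp add: sum.If_cases Int_def)
  also have "\<dots> = (\<Sum>C\<in>cycles 8 G. \<Sum>e\<in>F. if e \<in> edges C then 1 else 0)" by (rule sum.swap)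
  also have "\<dots> = (\<Sum>C\<in>cycles 8 G. card (edges C \<inter> F))"
    using assms by (simp add: sum.If_cases Int_def conj_commute)
  finally show ?thesis .
qed

section \<open>Words of steps\<close>

text \<open>A walk in \<open>G(n,k)\<close> crosses a spoke or moves forwards or backwards along the rim it is on.
  Which rim that is follows from the starting rim and the number of spokes crossed so far.\<close>

datatype step = Sp | Fw | Bw

fun opp :: "step \<Rightarrow> step" where
  "opp Sp = Sp" | "opp Fw = Bw" | "opp Bw = Fw"

fun sgn_step :: "step \<Rightarrow> int" where
  "sgn_step Sp = 0" | "sgn_step Fw = 1" | "sgn_step Bw = -1"

text \<open>The steps along rim \<open>c\<close> in a walk that starts on rim \<open>b\<close>. Throughout, \<open>True\<close> stands for the
  outer rim and \<open>False\<close> for the inner one.\<close>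

fun rims :: "bool \<Rightarrow> bool \<Rightarrow> step list \<Rightarrow> nat" where
  "rims c b [] = 0"
| "rims c b (Sp # ts) = rims c (\<not> b) ts"
| "rims c b (Fw # ts) = (if b = c then 1 else 0) + rims c b ts"
| "rims c b (Bw # ts) = (if b = c then 1 else 0) + rims c b ts"

abbreviation two_spoke_words :: "step \<Rightarrow> step \<Rightarrow> step list set" where
  "two_spoke_words a b \<equiv>
     {[a, Sp, b, b, b, b, b, Sp], [a, a, Sp, b, b, b, b, Sp], [a, a, a, Sp, b, b, b, Sp],
      [a, a, a, a, Sp, b, b, Sp], [a, a, a, a, a, Sp, b, Sp]}"

text \<open>A closed walk without backtracking keeps its direction between consecutive spokes and
  never crosses two spokes in a row, so it is determined by the positions of its spokes and a
  direction for each stretch. Starting just after a spoke that leads to the outer rim fixes the last letter, and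
  the number of spokes is even; eight steps then leave room for two or four spokes only.\<close>

lemma word_shapes:
  assumes "length us = 7" "successively (\<lambda>s t. t \<noteq> opp s) (us @ [Sp])" "hd us \<noteq> Sp"
    "even (count_list (us @ [Sp]) Sp)"
  shows "(\<exists>a b. a \<noteq> Sp \<and> b \<noteq> Sp \<and> us @ [Sp] \<in> two_spoke_words a b) \<or>
    (\<exists>a b c d. a \<noteq> Sp \<and> b \<noteq> Sp \<and> c \<noteq> Sp \<and> d \<noteq> Sp \<and> us @ [Sp] = [a, Sp, b, Sp, c, Sp, d, Sp])"
proof -
  obtain t0 t1 t2 t3 t4 t5 t6 where us: "us = [t0, t1, t2, t3, t4, t5, t6]"
    using assms(1) by (auto simp: numeral_eq_Suc length_Suc_conv)
  \<comment> \<open>Between spokes the direction cannot change.\<close>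
  have same: "t = s" if "s \<noteq> Sp" "t \<noteq> Sp" "t \<noteq> opp s" for s t
    using that by (cases s; cases t) auto
  have ends: "t0 \<noteq> Sp" "t6 \<noteq> Sp"
    and adj: "t1 \<noteq> opp t0" "t2 \<noteq> opp t1" "t3 \<noteq> opp t2" "t4 \<noteq> opp t3" "t5 \<noteq> opp t4" "t6 \<noteq> opp t5"
    and par: "even (count_list (us @ [Sp]) Sp)"
    using assms by (auto simp: us)
  \<comment> \<open>Adjacent spokes are excluded, and the last letter accounts for one spoke, so an odd
    number of spokes lies among the five middle positions.\<close>
  have pats: "t1 = Sp \<and> t2 \<noteq> Sp \<and> t3 \<noteq> Sp \<and> t4 \<noteq> Sp \<and> t5 \<noteq> Sp \<or>
    t1 \<noteq> Sp \<and> t2 = Sp \<and> t3 \<noteq> Sp \<and> t4 \<noteq> Sp \<and> t5 \<noteq> Sp \<or>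
    t1 \<noteq> Sp \<and> t2 \<noteq> Sp \<and> t3 = Sp \<and> t4 \<noteq> Sp \<and> t5 \<noteq> Sp \<or>
    t1 \<noteq> Sp \<and> t2 \<noteq> Sp \<and> t3 \<noteq> Sp \<and> t4 = Sp \<and> t5 \<noteq> Sp \<or>
    t1 \<noteq> Sp \<and> t2 \<noteq> Sp \<and> t3 \<noteq> Sp \<and> t4 \<noteq> Sp \<and> t5 = Sp \<or>
    t1 = Sp \<and> t2 \<noteq> Sp \<and> t3 = Sp \<and> t4 \<noteq> Sp \<and> t5 = Sp"
    using par adj ends unfolding us
    by (cases "t1 = Sp"; cases "t2 = Sp"; cases "t3 = Sp"; cases "t4 = Sp"; cases "t5 = Sp") simp_all
  show ?thesis
    using pats
  proof (elim disjE conjE)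
    assume *: "t1 = Sp" "t2 \<noteq> Sp" "t3 \<noteq> Sp" "t4 \<noteq> Sp" "t5 \<noteq> Sp"
    then have "t3 = t2" "t4 = t2" "t5 = t2" "t6 = t2" using same adj ends by metis+
    then show ?thesis using * ends us by simp
  next
    assume *: "t1 \<noteq> Sp" "t2 = Sp" "t3 \<noteq> Sp" "t4 \<noteq> Sp" "t5 \<noteq> Sp"
    then have "t1 = t0" "t4 = t3" "t5 = t3" "t6 = t3" using same adj ends by metis+
    then show ?thesis using * ends us by simp
  next
    assume *: "t1 \<noteq> Sp" "t2 \<noteq> Sp" "t3 = Sp" "t4 \<noteq> Sp" "t5 \<noteq> Sp"
    then have "t1 = t0" "t2 = t0" "t5 = t4" "t6 = t4" using same adj ends by metis+
    then show ?thesis using * ends us by simp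
  next
    assume *: "t1 \<noteq> Sp" "t2 \<noteq> Sp" "t3 \<noteq> Sp" "t4 = Sp" "t5 \<noteq> Sp"
    then have "t1 = t0" "t2 = t0" "t3 = t0" "t6 = t5" using same adj ends by metis+
    then show ?thesis using * ends us by simp
  next
    assume *: "t1 \<noteq> Sp" "t2 \<noteq> Sp" "t3 \<noteq> Sp" "t4 \<noteq> Sp" "t5 = Sp"
    then have "t1 = t0" "t2 = t0" "t3 = t0" "t4 = t0" using same adj ends by metis+
    then show ?thesis using * ends us by simp
  next
    assume "t1 = Sp" "t2 \<noteq> Sp" "t3 = Sp" "t4 \<noteq> Sp" "t5 = Sp"
    then show ?thesis using ends us by simp
  qed
qed

section \<open>Lifted positions in the generalized Petersen graph\<close>

locale large_petersen =
  fixes n k :: nat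
  assumes k_pos: "1 \<le> k" and k_less: "2 * k < n" and n_large: "40 < n"
begin

abbreviation G :: "gp_vertex graph" where "G \<equiv> gen_petersen n k"

definition stride :: "bool \<Rightarrow> int" where "stride b = (if b then 1 else int k)"

text \<open>Positions live in the universal cover: an integer instead of a residue. Walking is then
  integer addition, and reduction modulo \<open>n\<close> happens only when vertices are compared.\<close>

definition vx :: "bool \<times> int \<Rightarrow> gp_vertex" where
  "vx p = (if fst p then U else W) (nat (snd p mod int n))"

fun go :: "step \<Rightarrow> bool \<times> int \<Rightarrow> bool \<times> int" where
  "go Sp (b, z) = (\<not> b, z)"
| "go Fw (b, z) = (b, z + stride b)"
| "go Bw (b, z) = (b, z - stride b)"

lemma go_opp [simp]: "go (opp t) (go t p) = p" by (cases p; cases t) auto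

lemma vx_eq_iff [simp]: "vx (b, z) = vx (b', z') \<longleftrightarrow> b = b' \<and> int n dvd z - z'"
proof -
  have "nat (z mod int n) = nat (z' mod int n) \<longleftrightarrow> int n dvd z - z'"
    using n_large by (simp add: mod_eq_dvd_iff eq_nat_nat_iff)
  then show ?thesis by (auto simp: vx_def)
qed

lemma vx_of_nat: "i < n \<Longrightarrow> vx (True, int i) = U i" "i < n \<Longrightarrow> vx (False, int i) = W i"
  by (auto simp: vx_def)

lemma verts_G: "verts G = range vx"
proof -
  have "range vx \<subseteq> verts G" using n_large
    by (auto simp: vx_def gen_petersen_def nat_less_iff)
  moreover have "verts G \<subseteq> range vx"
    by (auto simp: gen_petersen_def vx_of_nat[symmetric])
  ultimately show ?thesis by auto
qed

definition rim :: "bool \<Rightarrow> int \<Rightarrow> gp_vertex set" where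
  "rim b z = {vx (b, z), vx (b, z + stride b)}"

definition spoke :: "int \<Rightarrow> gp_vertex set" where
  "spoke z = {vx (True, z), vx (False, z)}"

lemma stride_pos: "0 < stride b" and stride_less: "2 * stride b < int n"
  using k_pos k_less n_large by (auto simp: stride_def)

lemma not_dvd_small: "x \<noteq> 0 \<Longrightarrow> \<bar>x\<bar> < int n \<Longrightarrow> \<not> int n dvd x"
  using zdvd_not_zless[of "\<bar>x\<bar>" "int n"] by auto

text \<open>Here \<open>2k < n\<close> is essential: for \<open>2k = n\<close> the inner edges at \<open>z\<close> and at \<open>z + k\<close>
  would coincide.\<close>

lemma rim_eq_iff: "rim b z = rim b' z' \<longleftrightarrow> b = b' \<and> int n dvd z - z'"
proof
  assume *: "rim b z = rim b' z'"
  then have b: "b = b'" by (auto simp: rim_def doubleton_eq_iff)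
  have "\<not> (int n dvd z - (z' + stride b) \<and> int n dvd z + stride b - z')"
  proof
    assume "int n dvd z - (z' + stride b) \<and> int n dvd z + stride b - z'"
    then have "int n dvd (z + stride b - z') - (z - (z' + stride b))" by (blast intro: dvd_diff)
    then show False using not_dvd_small[of "2 * stride b"] stride_pos[of b] stride_less[of b] by simp
  qed
  then show "b = b' \<and> int n dvd z - z'" using * b by (auto simp: rim_def doubleton_eq_iff)
next
  assume "b = b' \<and> int n dvd z - z'"
  then have "vx (b, z) = vx (b', z')" "vx (b, z + stride b) = vx (b', z' + stride b')" by simp_all
  then show "rim b z = rim b' z'" by (simp only: rim_def)
qed

lemma spoke_eq_iff: "spoke z = spoke z' \<longleftrightarrow> int n dvd z - z'"
  by (auto simp: spoke_def doubleton_eq_iff)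

lemma spoke_neq_rim [simp]: "spoke z \<noteq> rim b z'" "rim b z' \<noteq> spoke z"
  by (auto simp: spoke_def rim_def doubleton_eq_iff)

text \<open>The common reason why each of the three orbits of edges is indexed by the residues
  modulo \<open>n\<close>, and hence has exactly \<open>n\<close> elements.\<close>

lemma range_periodic:
  assumes "\<And>z z' :: int. f z = f z' \<longleftrightarrow> int n dvd z - z'"
  shows "range f = (\<lambda>i. f (int i)) ` {..<n}" and "card (range f) = n"
proof -
  have "f z \<in> (\<lambda>i. f (int i)) ` {..<n}" for z
  proof
    show "f z = f (int (nat (z mod int n)))" using n_large assms by (simp add: mod_eq_dvd_iff[symmetric])
    show "nat (z mod int n) \<in> {..<n}" using n_large by (simp add: nat_less_iff)
  qed
  then show *: "range f = (\<lambda>i. f (int i)) ` {..<n}" by auto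
  have "inj_on (\<lambda>i. f (int i)) {..<n}"
  proof (rule inj_onI)
    fix i j assume "i \<in> {..<n}" "j \<in> {..<n}" "f (int i) = f (int j)"
    then show "i = j" using assms[of "int i" "int j"] not_dvd_small[of "int i - int j"] by force
  qed
  then show "card (range f) = n" by (simp add: * card_image)
qed

lemma edges_G: "edges G = range (rim True) \<union> range spoke \<union> range (rim False)"
proof -
  have "U ((i + 1) mod n) = vx (True, int i + 1)" "W ((i + k) mod n) = vx (False, int i + int k)" for i
    by (auto simp: vx_def nat_mod_distrib nat_add_distrib)
  then have "rim True (int i) = {U i, U ((i + 1) mod n)}"
    "rim False (int i) = {W i, W ((i + k) mod n)}"
    "spoke (int i) = {U i, W i}" if "i < n" for i
    using that by (auto simp: rim_def spoke_def vx_of_nat stride_def)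
  then have "range (rim True) = {{U i, U ((i + 1) mod n)} | i. i < n}"
    "range (rim False) = {{W i, W ((i + k) mod n)} | i. i < n}"
    "range spoke = {{U i, W i} | i. i < n}"
    using range_periodic(1)[of "rim True"] range_periodic(1)[of "rim False"] range_periodic(1)[of spoke]
    by (auto simp: rim_eq_iff spoke_eq_iff)
  then show ?thesis by (simp add: gen_petersen_def)
qed

lemma card_rims: "card (range (rim b)) = n" and card_spokes: "card (range spoke) = n"
  by (rule range_periodic(2); simp add: rim_eq_iff spoke_eq_iff)+

lemma finite_verts: "finite (verts G)" by (simp add: gen_petersen_def)

lemma edges_subset: "edges G \<subseteq> Pow (verts G)"
  by (auto simp: edges_G verts_G rim_def spoke_def)

lemma finite_cycles_G: "finite (cycles m G)"
  using finite_cycles[OF finite_verts edges_subset] .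

lemma sigma_rotation:
  "sigma G (rim b z) = sigma G (rim b 0)" "sigma G (spoke z) = sigma G (spoke 0)"
proof -
  define f where "f a v = (case v of U i \<Rightarrow> vx (True, int i + a) | W i \<Rightarrow> vx (False, int i + a))" for a v
  have f: "f a (vx (b, z)) = vx (b, z + a)" for a b z
    using n_large by (auto simp: f_def vx_def mod_simps)
  have le: "sigma G e \<le> sigma G (f a ` e)" for a e
  proof (rule sigma_le_image[OF finite_verts edges_subset])
    show "inj_on (f a) (verts G)"
      by (auto simp: verts_G f intro!: inj_onI)
    show "f a ` verts G \<subseteq> verts G" by (auto simp: verts_G f)
    have "f a ` rim b z = rim b (z + a)" "f a ` spoke z = spoke (z + a)" for b z
      by (auto simp: rim_def spoke_def f add_ac)
    then show "f a ` e \<in> edges G" if "e \<in> edges G" for e using that by (auto simp: edges_G)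
  qed
  have "f a ` rim b z = rim b (z + a)" "f a ` spoke z = spoke (z + a)" for a b z
    by (auto simp: rim_def spoke_def f add_ac)
  then have "sigma G (rim b z) \<le> sigma G (rim b (z + a))" "sigma G (spoke z) \<le> sigma G (spoke (z + a))" for a b z
    using le by metis+
  from this[where z = z and a = "-z"] this[where z = 0 and a = z]
  show "sigma G (rim b z) = sigma G (rim b 0)" "sigma G (spoke z) = sigma G (spoke 0)"
    by (simp_all add: order_antisym)
qed

section \<open>Cycles as closed words\<close>

text \<open>The vertices of a walk, without its end point: a closed walk is a cycle precisely when
  this list has no repetition.\<close>

fun visits :: "bool \<times> int \<Rightarrow> step list \<Rightarrow> gp_vertex list" where
  "visits p [] = []"
| "visits p (t # ts) = vx p # visits (go t p) ts"

fun trail :: "bool \<times> int \<Rightarrow> step list \<Rightarrow> gp_vertex set list" where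
  "trail p [] = []"
| "trail p (t # ts) = {vx p, vx (go t p)} # trail (go t p) ts"

definition traces :: "gp_vertex graph \<Rightarrow> bool \<times> int \<Rightarrow> step list \<Rightarrow> bool" where
  "traces C p ts \<longleftrightarrow> length ts = 8 \<and> distinct (visits p ts) \<and> vx (fold go ts p) = vx p \<and>
     verts C = set (visits p ts) \<and> edges C = set (trail p ts)"

lemma length_visits [simp]: "length (visits p ts) = length ts" by (induction ts arbitrary: p) auto
lemma length_trail [simp]: "length (trail p ts) = length ts" by (induction ts arbitrary: p) auto

lemma visits_append: "visits p (xs @ ys) = visits p xs @ visits (fold go xs p) ys"
  by (induction xs arbitrary: p) auto

lemma trail_append: "trail p (xs @ ys) = trail p xs @ trail (fold go xs p) ys"
  by (induction xs arbitrary: p) auto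

lemma trail_nth:
  "i < length ts \<Longrightarrow> trail p ts ! i = {(visits p ts @ [vx (fold go ts p)]) ! i, (visits p ts @ [vx (fold go ts p)]) ! Suc i}"
proof (induction ts arbitrary: p i)
  case (Cons t ts)
  show ?case
  proof (cases i)
    case 0 then show ?thesis by (cases ts) auto
  next
    case (Suc j) then show ?thesis using Cons by simp
  qed
qed simp

lemma vx_go_cong:
  assumes "vx p = vx q"
  shows "vx (go t p) = vx (go t q)"
  using assms by (cases p; cases q; cases t) auto

lemma visits_trail_cong:
  assumes "vx p = vx q"
  shows "visits p ts = visits q ts" "trail p ts = trail q ts" "vx (fold go ts p) = vx (fold go ts q)"
proof (atomize (full), use assms in \<open>induction ts arbitrary: p q\<close>)
  case (Cons t ts)
  show ?case
    using Cons.IH[OF vx_go_cong[OF Cons.prems]] Cons.prems vx_go_cong[OF Cons.prems] by simp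
qed simp

lemma trail_subset: "set (trail p ts) \<subseteq> edges G"
proof (induction ts arbitrary: p)
  case (Cons t ts)
  obtain b z where p: "p = (b, z)" by force
  have "{vx p, vx (go t p)} \<in> edges G"
    by (cases b; cases t) (auto simp: p edges_G rim_def spoke_def image_iff insert_commute,
      (metis diff_add_cancel insert_commute)+)
  then show ?case using Cons by auto
qed simp

lemma adjacent_step:
  assumes "{vx p, q} \<in> edges G"
  shows "\<exists>t. q = vx (go t p)"
proof -
  obtain b z where p: "p = (b, z)" by force
  have rim: "\<exists>t. q = vx (go t p)" if "{vx p, q} = rim c y" for c y
  proof -
    from that consider "vx p = vx (c, y)" "q = vx (c, y + stride c)"
      | "vx p = vx (c, y + stride c)" "q = vx (c, y)"
      by (auto simp: rim_def doubleton_eq_iff)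
    then show ?thesis
    proof cases
      case 1 then show ?thesis by (intro exI[of _ Fw]) (auto simp: p dvd_diff_commute)
    next
      case 2 then show ?thesis by (intro exI[of _ Bw]) (auto simp: p algebra_simps dvd_diff_commute)
    qed
  qed
  have spk: "\<exists>t. q = vx (go t p)" if "{vx p, q} = spoke y" for y
    using that by (intro exI[of _ Sp]) (auto simp: p spoke_def doubleton_eq_iff dvd_diff_commute)
  show ?thesis using assms rim spk by (auto simp: edges_G)
qed

text \<open>Path lifting: every walk in the graph is the projection of a walk in the cover.\<close>

lemma walk_lift:
  assumes "\<And>i. i < m \<Longrightarrow> {w i, w (Suc i)} \<in> edges G" and "w 0 = vx p"
  shows "\<exists>ts. length ts = m \<and> visits p ts = map w [0..<m] \<and>
    trail p ts = map (\<lambda>i. {w i, w (Suc i)}) [0..<m] \<and> vx (fold go ts p) = w m"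
  using assms
proof (induction m)
  case (Suc m)
  then obtain ts where ts: "length ts = m" "visits p ts = map w [0..<m]"
    "trail p ts = map (\<lambda>i. {w i, w (Suc i)}) [0..<m]" "vx (fold go ts p) = w m" by auto
  obtain t where "w (Suc m) = vx (go t (fold go ts p))"
    using adjacent_step[of "fold go ts p" "w (Suc m)"] Suc.prems(1)[of m] ts(4) by auto
  with ts show ?case
    by (intro exI[of _ "ts @ [t]"]) (simp add: visits_append trail_append)
qed simp

lemma cycle_traced:
  assumes "C \<in> cycles 8 G"
  shows "\<exists>p ts. traces C p ts"
proof -
  from assms obtain c where c: "inj_on c {..<8}" "verts C = c ` {..<8::nat}"
    "edges C = {{c i, c (Suc i mod 8)} | i. i < 8}" and sub: "verts C \<subseteq> verts G" "edges C \<subseteq> edges G"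
    by (auto simp: cycles_def cycle_graph_def subgraph_def)
  define w where "w i = c (i mod 8)" for i
  have "c 0 \<in> verts G" using c(2) sub(1) by auto
  then obtain p where p: "c 0 = vx p" by (auto simp: verts_G)
  have "{w i, w (Suc i)} \<in> edges G" if "i < 8" for i
    using sub(2) that by (auto simp: c(3) w_def)
  then obtain ts where ts: "length ts = 8" "visits p ts = map w [0..<8]"
    "trail p ts = map (\<lambda>i. {w i, w (Suc i)}) [0..<8]" "vx (fold go ts p) = w 8"
    using walk_lift[of 8 w p] p by (auto simp: w_def)
  have "distinct (visits p ts)" unfolding ts(2)
    using c(1) by (auto simp: distinct_map w_def inj_on_def)
  moreover have "verts C = set (visits p ts)" by (auto simp: ts(2) c(2) w_def)
  moreover have "edges C = set (trail p ts)" by (auto simp: ts(3) c(3) w_def image_iff)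
  ultimately have "traces C p ts" using ts p by (simp add: traces_def w_def)
  then show ?thesis by blast
qed

lemma closed_trail_nth:
  assumes "length ts = 8" "vx (fold go ts p) = vx p" "i < 8"
  shows "trail p ts ! i = {visits p ts ! i, visits p ts ! (Suc i mod 8)}"
proof -
  have "vx (fold go ts p) = visits p ts ! 0" using assms by (cases ts) auto
  then show ?thesis using trail_nth[of i ts p] assms
    by (cases "i = 7") (auto simp: nth_append mod_Suc)
qed

lemma distinct_trail:
  assumes "traces C p ts"
  shows "distinct (trail p ts)"
proof -
  define vs where "vs = visits p ts"
  have ts: "length vs = 8" "length ts = 8" "distinct vs"
    using assms by (simp_all add: vs_def traces_def)
  have nth: "trail p ts ! i = {vs ! i, vs ! (Suc i mod 8)}" if "i < 8" for i
    using closed_trail_nth[of ts p i] assms that by (simp add: vs_def traces_def)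
  show ?thesis unfolding distinct_conv_nth
  proof (intro allI impI)
    fix i j assume ij: "i < length (trail p ts)" "j < length (trail p ts)" "i \<noteq> j"
    then have "\<not> (i = Suc j mod 8 \<and> Suc i mod 8 = j)" using ts by (auto simp: mod_Suc split: if_splits)
    then show "trail p ts ! i \<noteq> trail p ts ! j"
      using ij ts by (auto simp: nth doubleton_eq_iff nth_eq_iff_index_eq)
  qed
qed

lemma traced_cycle:
  assumes "length ts = 8" "distinct (visits p ts)" "vx (fold go ts p) = vx p"
  shows "(set (visits p ts), set (trail p ts)) \<in> cycles 8 G"
proof -
  define vs where "vs = visits p ts"
  have ts: "length vs = 8" "length ts = 8" "distinct vs"
    using assms by (simp_all add: vs_def traces_def)
  have nth: "trail p ts ! i = {vs ! i, vs ! (Suc i mod 8)}" if "i < 8" for i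
    using closed_trail_nth[of ts p i] assms that by (simp add: vs_def traces_def)
  have "set vs \<subseteq> verts G"
    unfolding vs_def verts_G by (induction ts arbitrary: p) auto
  moreover have "set (trail p ts) = {{vs ! i, vs ! (Suc i mod 8)} | i. i < 8}"
    using ts by (auto simp: set_conv_nth nth) (use nth in metis)
  moreover have "inj_on ((!) vs) {..<8}" using ts by (auto simp: inj_on_nth)
  moreover have "set vs = (!) vs ` {..<8}" using ts by (auto simp: set_conv_nth)
  ultimately show ?thesis
    using trail_subset[of p ts] unfolding vs_def[symmetric]
    by (auto simp: cycles_def subgraph_def cycle_graph_def)
qed

text \<open>A cycle may be traced from any of its vertices.\<close>

lemma traces_rotate:
  assumes "traces C p (xs @ ys)"
  shows "traces C (fold go xs p) (ys @ xs)"
proof -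
  have *: "vx (fold go ys (fold go xs p)) = vx p" using assms by (simp add: traces_def)
  show ?thesis using assms visits_trail_cong[OF *]
    by (auto simp: traces_def visits_append trail_append)
qed

lemma fold_opp: "fold go (map opp (rev ts)) (fold go ts p) = p"
  by (induction ts arbitrary: p) simp_all

lemma visits_opp:
  "vx p # rev (visits (fold go ts p) (map opp (rev ts))) = visits p ts @ [vx (fold go ts p)]"
proof (induction ts arbitrary: p)
  case (Cons t ts)
  show ?case using Cons[of "go t p"] by (simp add: visits_append fold_opp)
qed simp

lemma trail_opp: "trail (fold go ts p) (map opp (rev ts)) = rev (trail p ts)"
proof (induction ts arbitrary: p)
  case (Cons t ts)
  show ?case using Cons[of "go t p"] by (simp add: trail_append fold_opp insert_commute)
qed simp

text \<open>A cycle may be traced in the opposite direction.\<close>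

lemma traces_opp:
  assumes "traces C p ts"
  shows "traces C p (map opp (rev ts))"
proof -
  define q where "q = fold go ts p"
  have q: "vx q = vx p" using assms by (simp add: traces_def q_def)
  have v: "vx p # rev (visits q (map opp (rev ts))) = visits p ts @ [vx p]"
    using visits_opp[of p ts] q by (simp add: q_def)
  obtain vs where vs: "visits p ts = vx p # vs"
    using assms by (cases ts) (auto simp: traces_def)
  with v have "rev (visits q (map opp (rev ts))) = vs @ [vx p]" by simp
  then have "visits q (map opp (rev ts)) = vx p # rev vs" by (simp add: rev_swap)
  then show ?thesis
    using assms fold_opp[of ts p] visits_trail_cong[OF q] trail_opp[of ts p] vs
    by (auto simp: traces_def q_def[symmetric])
qed

section \<open>Classification of the 8-cycles\<close>

definition rim_count :: "bool \<Rightarrow> gp_vertex graph \<Rightarrow> nat" where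
  "rim_count b C = card (edges C \<inter> range (rim b))"

definition spoke_count :: "gp_vertex graph \<Rightarrow> nat" where
  "spoke_count C = card (edges C \<inter> range spoke)"

lemma step_edge:
  "{vx (b, z), vx (go t (b, z))} =
     (case t of Sp \<Rightarrow> spoke z | Fw \<Rightarrow> rim b z | Bw \<Rightarrow> rim b (z - stride b))"
  by (cases t; cases b) (auto simp: rim_def spoke_def)

lemma rim_in_rims: "rim b z \<in> range (rim c) \<longleftrightarrow> b = c"
  by (auto simp: rim_eq_iff)

lemma filter_trail:
  "length (filter (\<lambda>e. e \<in> range (rim c)) (trail (b, z) ts)) = rims c b ts"
  "length (filter (\<lambda>e. e \<in> range spoke) (trail (b, z) ts)) = count_list ts Sp"
proof (induction c b ts arbitrary: z rule: rims.induct)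
  case (2 c b ts)
  {case 1 then show ?case using 2 step_edge[of b z Sp] by auto}
  {case 2 then show ?case using "2.IH" step_edge[of b z Sp] by auto}
next
  case (3 c b ts)
  {case 1 then show ?case using 3 step_edge[of b z Fw] by (auto simp: rim_in_rims)}
  {case 2 then show ?case using 3 step_edge[of b z Fw] by auto}
next
  case (4 c b ts)
  {case 1 then show ?case using 4 step_edge[of b z Bw] by (auto simp: rim_in_rims)}
  {case 2 then show ?case using 4 step_edge[of b z Bw] by auto}
qed auto

text \<open>The edges of a trace are pairwise distinct, so counting letters of the word counts edges
  of the cycle.\<close>

lemma counts_of_trace:
  assumes "traces C (b, z) ts"
  shows "rim_count c C = rims c b ts" "spoke_count C = count_list ts Sp"
proof -
  have *: "card (edges C \<inter> X) = length (filter (\<lambda>e. e \<in> X) (trail (b, z) ts))" for X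
    using assms distinct_trail[OF assms]
    by (metis distinct_card distinct_filter inf_commute inter_set_filter traces_def)
  show "rim_count c C = rims c b ts" "spoke_count C = count_list ts Sp"
    unfolding rim_count_def spoke_count_def * filter_trail by simp_all
qed

text \<open>Two mutually inverse consecutive steps return to a vertex that has already been visited
  and, as the word has length eight, is not merely the end point of the closed walk.\<close>

lemma no_backtrack:
  assumes "traces C p (xs @ s # t # ys)"
  shows "t \<noteq> opp s"
proof
  assume t: "t = opp s"
  define q where "q = fold go xs p"
  have tr: "traces C q (s # t # ys @ xs)"
    using traces_rotate[OF assms] by (simp add: q_def)
  then obtain r rs where "ys @ xs = r # rs" by (cases "ys @ xs") (auto simp: traces_def)
  with tr t show False by (simp add: traces_def)
qed

lemma fst_fold_go: "fst (fold go ts p) \<longleftrightarrow> (fst p = even (count_list ts Sp))"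
proof (induction ts arbitrary: p)
  case (Cons t ts)
  then show ?case by (cases p; cases t) auto
qed simp

lemma closed_fst: "vx (fold go ts p) = vx p \<Longrightarrow> fst (fold go ts p) = fst p"
  by (cases p; cases "fold go ts p") simp

lemma leaves_inner:
  assumes "\<not> fst p" "fst (fold go ts p)"
  shows "\<exists>xs ys. ts = xs @ Sp # ys \<and> \<not> fst (fold go xs p)"
  using assms
proof (induction ts arbitrary: p)
  case (Cons t ts)
  show ?case
  proof (cases "t = Sp")
    case True
    then show ?thesis using Cons.prems(1) by (intro exI[of _ "[]"] exI[of _ ts]) simp
  next
    case False
    then have "fst (go t p) = fst p" by (cases p; cases t) auto
    then obtain xs ys where "ts = xs @ Sp # ys" "\<not> fst (fold go xs (go t p))"
      using Cons.IH[of "go t p"] Cons.prems by auto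
    then show ?thesis by (intro exI[of _ "t # xs"] exI[of _ ys]) simp
  qed
qed simp

text \<open>A closed walk that uses a spoke crosses spokes alternately outwards and inwards; rotating
  the word so that an outward one comes last gives the normal form.\<close>

lemma trace_from_outer:
  assumes "traces C p ts" "Sp \<in> set ts"
  shows "\<exists>z us. traces C (True, z) (us @ [Sp])"
proof -
  have enter: "\<exists>z us. traces C (True, z) (us @ [Sp])"
    if tr: "traces C q (xs @ Sp # ys)" and inner: "\<not> fst (fold go xs q)" for q xs ys
  proof -
    obtain z where "fold go xs q = (False, z)" using inner by (cases "fold go xs q") auto
    then show ?thesis using traces_rotate[of C q "xs @ [Sp]" ys] tr
      by (intro exI[of _ z] exI[of _ "ys @ xs"]) simp
  qed
  obtain xs ys where ts: "ts = xs @ Sp # ys" using assms(2) by (meson split_list)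
  show ?thesis
  proof (cases "fst (fold go xs p)")
    case False
    then show ?thesis using enter assms(1) ts by blast
  next
    case True
    define q where "q = fold go (xs @ [Sp]) p"
    have tr: "traces C q ((ys @ xs) @ [Sp])"
      using traces_rotate[of C p "xs @ [Sp]" ys] assms(1) ts by (simp add: q_def)
    have nq: "\<not> fst q" using True by (cases "fold go xs p") (simp add: q_def)
    moreover have "fst (fold go (ys @ xs) q)"
      using tr closed_fst[of "(ys @ xs) @ [Sp]" q] nq
      by (cases "fold go (ys @ xs) q") (auto simp: traces_def)
    ultimately obtain as bs where "ys @ xs = as @ Sp # bs" "\<not> fst (fold go as q)"
      using leaves_inner by blast
    then show ?thesis using enter[of q as "bs @ [Sp]"] tr by simp
  qed
qed

text \<open>Without spokes the walk stays on one rim; the outer rim is excluded because its closed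
  walks without backtracking have length at least \<open>n\<close>.\<close>

lemma cycle_words:
  assumes "C \<in> cycles 8 G"
  obtains (inner) z a where "a \<noteq> Sp" "traces C (False, z) [a, a, a, a, a, a, a, a]"
  | (two) z a b ts where "a \<noteq> Sp" "b \<noteq> Sp" "traces C (True, z) ts"
      "ts \<in> two_spoke_words a b"
  | (four) z a b c d where "a \<noteq> Sp" "b \<noteq> Sp" "c \<noteq> Sp" "d \<noteq> Sp"
      "traces C (True, z) [a, Sp, b, Sp, c, Sp, d, Sp]"
proof -
  obtain p ts where tr: "traces C p ts" using cycle_traced[OF assms] by blast
  have succ: "successively (\<lambda>s t. t \<noteq> opp s) ts" if "traces C p ts" for p ts
    unfolding successively_conv_nth
  proof (intro allI impI)
    fix i assume i: "Suc i < length ts"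
    then have "ts = take i ts @ ts ! i # ts ! Suc i # drop (Suc (Suc i)) ts"
      by (metis Cons_nth_drop_Suc Suc_lessD append_take_drop_id)
    then show "ts ! Suc i \<noteq> opp (ts ! i)" using that no_backtrack by metis
  qed
  show thesis
  proof (cases "Sp \<in> set ts")
    case True
    then obtain z us where us: "traces C (True, z) (us @ [Sp])"
      using trace_from_outer tr by blast
    then have len: "length us = 7" by (simp add: traces_def)
    have "hd us \<noteq> Sp"
      using no_backtrack[of C _ "[]" Sp "hd us" "tl us"] traces_rotate[OF us] len
      by (cases us) auto
    moreover have "even (count_list (us @ [Sp]) Sp)"
      using us closed_fst[of "us @ [Sp]" "(True, z)"] fst_fold_go[of "us @ [Sp]" "(True, z)"]
      by (simp add: traces_def)
    ultimately have "(\<exists>a b. a \<noteq> Sp \<and> b \<noteq> Sp \<and> us @ [Sp] \<in> two_spoke_words a b) \<or>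
        (\<exists>a b c d. a \<noteq> Sp \<and> b \<noteq> Sp \<and> c \<noteq> Sp \<and> d \<noteq> Sp \<and> us @ [Sp] = [a, Sp, b, Sp, c, Sp, d, Sp])"
      by (rule word_shapes[OF len succ[OF us]])
    then show thesis
    proof (elim disjE exE conjE)
      fix a b
      assume "a \<noteq> Sp" "b \<noteq> Sp" and shape: "us @ [Sp] \<in> two_spoke_words a b"
      then show thesis using two[OF _ _ us shape] by simp
    next
      fix a b c d
      assume "a \<noteq> Sp" "b \<noteq> Sp" "c \<noteq> Sp" "d \<noteq> Sp" "us @ [Sp] = [a, Sp, b, Sp, c, Sp, d, Sp]"
      then show thesis using four us by simp
    qed
  next
    case False
    obtain t0 t1 t2 t3 t4 t5 t6 t7 where ts: "ts = [t0, t1, t2, t3, t4, t5, t6, t7]"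
      using tr by (auto simp: traces_def numeral_eq_Suc length_Suc_conv)
    have same: "t = s" if "s \<noteq> Sp" "t \<noteq> Sp" "t \<noteq> opp s" for s t
      using that by (cases s; cases t) auto
    have ne: "t0 \<noteq> Sp" "t1 \<noteq> Sp" "t2 \<noteq> Sp" "t3 \<noteq> Sp" "t4 \<noteq> Sp" "t5 \<noteq> Sp" "t6 \<noteq> Sp" "t7 \<noteq> Sp"
      and adj: "t1 \<noteq> opp t0" "t2 \<noteq> opp t1" "t3 \<noteq> opp t2" "t4 \<noteq> opp t3" "t5 \<noteq> opp t4"
        "t6 \<noteq> opp t5" "t7 \<noteq> opp t6"
      using succ[OF tr] False unfolding ts by auto
    have "t1 = t0" "t2 = t1" "t3 = t2" "t4 = t3" "t5 = t4" "t6 = t5" "t7 = t6"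
      by (rule same; fact)+
    with ne have "ts = [t0, t0, t0, t0, t0, t0, t0, t0]" "t0 \<noteq> Sp" using ts by simp_all
    moreover obtain b z where p: "p = (b, z)" by force
    \<comment> \<open>Eight steps do not go round the outer rim.\<close>
    moreover have "\<not> b"
    proof
      assume b
      then have "int n dvd 8 \<or> int n dvd - 8"
        using tr calculation by (cases t0) (auto simp: traces_def stride_def)
      then show False using not_dvd_small[of 8] n_large by auto
    qed
    ultimately show thesis using tr inner by simp
  qed
qed

lemma go_rim [simp]: "t \<noteq> Sp \<Longrightarrow> go t (b, z) = (b, z + sgn_step t * stride b)"
  by (cases t) auto

lemma rims_rim [simp]: "t \<noteq> Sp \<Longrightarrow> rims c b (t # ts) = (if b = c then 1 else 0) + rims c b ts"
  by (cases t) auto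

text \<open>A walk with \<open>a\<close> outer and \<open>b\<close> inner steps, all in the same direction on each rim, closes up
  for some choice of the two directions.\<close>

definition closes :: "nat \<Rightarrow> nat \<Rightarrow> bool" where
  "closes a b \<longleftrightarrow> (\<exists>s t. s \<noteq> Sp \<and> t \<noteq> Sp \<and> int n dvd sgn_step s * int a + sgn_step t * (int b * int k))"

lemma closed_dvd:
  assumes "traces C (b, z) ts"
  shows "int n dvd snd (fold go ts (b, z)) - z"
  using assms by (cases "fold go ts (b, z)") (simp add: traces_def)

text \<open>On each rim a word with two spokes moves in one direction only, so its edge counts are also
  its displacements up to sign; that the walk is closed turns them into a divisibility.\<close>

lemma cycle_types:
  assumes "C \<in> cycles 8 G"
  obtains (inner) "rim_count True C = 0" "rim_count False C = 8" "spoke_count C = 0" "closes 0 8"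
  | (two) i where "i \<in> {1..5}" "rim_count True C = i" "rim_count False C = 6 - i" "spoke_count C = 2"
      "closes i (6 - i)"
  | (four) "rim_count True C = 2" "rim_count False C = 2" "spoke_count C = 4"
  using assms
proof (cases rule: cycle_words)
  case (inner z a)
  have "int n dvd sgn_step a * int 0 + sgn_step a * (int 8 * int k)"
    using closed_dvd[OF inner(2)] inner(1) by (simp add: stride_def algebra_simps)
  then have "closes 0 8" using inner(1) unfolding closes_def by blast
  then show thesis using that(1) counts_of_trace[OF inner(2)] inner(1) by simp
next
  case (two z a b ts)
  define i where "i = rims True True ts"
  have "snd (fold go ts (True, z)) - z = sgn_step a * int i + sgn_step b * (int (6 - i) * int k)"
    using two(4) by (elim insertE emptyE) (simp_all add: two(1,2) i_def stride_def algebra_simps)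
  then have "closes i (6 - i)"
    using closed_dvd[OF two(3)] two(1,2) unfolding closes_def by metis
  moreover have "i \<in> {1..5} \<and> rims False True ts = 6 - i \<and> count_list ts Sp = 2"
    using two(4) by (elim insertE emptyE) (simp_all add: two(1,2) i_def)
  ultimately show thesis using that(2)[of i] counts_of_trace[OF two(3)] by (simp add: i_def)
next
  case (four z a b c d)
  then show thesis using that(3) counts_of_trace[OF four(5)] by simp
qed

text \<open>Eliminating \<open>k\<close> from the two relations shows that \<open>n\<close> divides \<open>\<plusminus>ad \<plusminus> cb\<close>, which is too
  small to be a nonzero multiple of \<open>n\<close>.\<close>

lemma closes_parallel:
  assumes "closes a b" "closes c d" "a * d + c * b < n"
  shows "a * d = c * b"
proof -
  have sgn: "t \<noteq> Sp \<Longrightarrow> sgn_step t = 1 \<or> sgn_step t = -1" for t by (cases t) auto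
  obtain s t where st: "sgn_step s = 1 \<or> sgn_step s = -1" "sgn_step t = 1 \<or> sgn_step t = -1"
    "int n dvd sgn_step s * int a + sgn_step t * (int b * int k)"
    using assms(1) sgn unfolding closes_def by blast
  obtain u v where uv: "sgn_step u = 1 \<or> sgn_step u = -1" "sgn_step v = 1 \<or> sgn_step v = -1"
    "int n dvd sgn_step u * int c + sgn_step v * (int d * int k)"
    using assms(2) sgn unfolding closes_def by blast
  let ?x = "sgn_step v * sgn_step s * int (a * d) - sgn_step t * sgn_step u * int (c * b)"
  have "int n dvd sgn_step v * int d * (sgn_step s * int a + sgn_step t * (int b * int k)) -
      sgn_step t * int b * (sgn_step u * int c + sgn_step v * (int d * int k))"
    by (intro dvd_diff dvd_mult st uv)
  also have "\<dots> = ?x" by (simp add: algebra_simps)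
  finally have dvd: "int n dvd ?x" .
  have "int (a * d) + int (c * b) < int n" using assms(3) by linarith
  then have "\<bar>?x\<bar> < int n" using st(1,2) uv(1,2) by (elim disjE) (simp_all del: of_nat_mult)
  then have "?x = 0" using dvd not_dvd_small by blast
  then have "int (a * d) = int (c * b) \<or> int (a * d) = - int (c * b)"
    using st(1,2) uv(1,2) by (elim disjE) (auto simp del: of_nat_mult)
  then show ?thesis by linarith
qed

text \<open>Proportional pairs \<open>(outer, inner)\<close> are ordered in the same way. The largest value of
  \<open>ad + cb\<close> is attained for \<open>(5,1)\<close> and \<open>(0,8)\<close> and equals 40.\<close>

lemma same_bias:
  assumes "C \<in> cycles 8 G" "D \<in> cycles 8 G"
  shows "rim_count b C < rim_count (\<not> b) C \<Longrightarrow> rim_count b D \<le> rim_count (\<not> b) D"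
proof -
  have parallel: "rim_count True C * rim_count False D = rim_count True D * rim_count False C"
    if "closes (rim_count True C) (rim_count False C)" "closes (rim_count True D) (rim_count False D)"
      "rim_count True C * rim_count False D + rim_count True D * rim_count False C \<le> 40"
    using closes_parallel that n_large by simp
  have types: "rim_count True C = rim_count False C \<or> closes (rim_count True C) (rim_count False C) \<and>
      (rim_count True C, rim_count False C) \<in> {(0, 8), (1, 5), (2, 4), (3, 3), (4, 2), (5, 1)}"
    if "C \<in> cycles 8 G" for C
    using that
  proof (cases rule: cycle_types)
    case (two i)
    then have "i \<in> {1, 2, 3, 4, 5}" by auto
    then show ?thesis using two by auto
  qed auto
  show "rim_count b C < rim_count (\<not> b) C \<Longrightarrow> rim_count b D \<le> rim_count (\<not> b) D"
    using types[OF assms(1)] types[OF assms(2)] parallel by (cases b) auto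
qed

section \<open>Counting 8-cycles with equally many outer and inner edges\<close>

lemma trail_Cons:
  "trail (b, z) (t # ts) = (case t of Sp \<Rightarrow> spoke z | Fw \<Rightarrow> rim b z | Bw \<Rightarrow> rim b (z - stride b)) # trail (go t (b, z)) ts"
  by (simp add: step_edge del: go_rim)

text \<open>For each \<open>z\<close>, going round the commutator of the outer step \<open>+1\<close> and the inner step \<open>+k\<close>
  gives a cycle. Its outer edges are those at \<open>z\<close> and \<open>z + k\<close>, and as \<open>n\<close> does not divide
  \<open>2k\<close>, this pair determines \<open>z\<close>.\<close>

lemma four_spoke_cycles:
  assumes "1 < k"
  shows "n \<le> card {C \<in> cycles 8 G. spoke_count C = 4}"
proof -
  define ts where "ts = [Fw, Sp, Fw, Sp, Bw, Sp, Bw, Sp]"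
  define B where "B z = (set (visits (True, z) ts), set (trail (True, z) ts))" for z
  have nd: "\<not> int n dvd 1" "\<not> int n dvd int k" "\<not> int n dvd int k + 1" "\<not> int n dvd 1 + int k"
    "\<not> int n dvd int k - 1" "\<not> int n dvd 2 * int k"
    "\<not> int n dvd - int k" "\<not> int n dvd - int k - 1" "\<not> int n dvd - 1 - int k" "\<not> int n dvd 1 - int k"
    by (rule not_dvd_small; use assms k_less n_large in linarith)+
  have dist: "distinct (visits (True, z) ts)" for z
    using nd by (simp add: ts_def stride_def)
  have tr: "traces (B z) (True, z) ts" for z
    using dist by (auto simp: traces_def B_def ts_def)
  have cyc: "B z \<in> cycles 8 G" for z
    unfolding B_def by (rule traced_cycle) (use dist in \<open>auto simp: ts_def\<close>)
  have four: "spoke_count (B z) = 4" for z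
    using counts_of_trace(2)[OF tr] by (simp add: ts_def)
  have outer: "rim True y \<in> edges (B z) \<longleftrightarrow> int n dvd y - z \<or> int n dvd y - (z + int k)" for y z
    by (auto simp: B_def ts_def trail_Cons rim_eq_iff stride_def simp del: trail.simps(2))
  have "inj_on B {0..<int n}"
  proof (rule inj_onI)
    fix x y assume xy: "x \<in> {0..<int n}" "y \<in> {0..<int n}" "B x = B y"
    then have "int n dvd x - y \<or> int n dvd x - (y + int k)" "int n dvd y - x \<or> int n dvd y - (x + int k)"
      using outer[of x x] outer[of y y] outer[of x y] outer[of y x] by auto
    moreover have "\<not> (int n dvd x - (y + int k) \<and> int n dvd y - (x + int k))"
    proof
      assume "int n dvd x - (y + int k) \<and> int n dvd y - (x + int k)"
      then have "int n dvd (x - (y + int k)) + (y - (x + int k))" by (blast intro: dvd_add)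
      then show False using nd(6) by simp
    qed
    ultimately have "int n dvd x - y" by (auto simp: dvd_diff_commute)
    then show "x = y" using xy not_dvd_small[of "x - y"] by force
  qed
  then have "card (B ` {0..<int n}) = n" by (simp add: card_image)
  moreover have "card (B ` {0..<int n}) \<le> card {C \<in> cycles 8 G. spoke_count C = 4}"
    by (rule card_mono) (use finite_cycles_G cyc four in auto)
  ultimately show ?thesis by simp
qed

text \<open>After a possible reversal, such a cycle starts with three forward outer steps from some
  position \<open>z\<close>. The direction on the inner rim is then forced, because \<open>n\<close> cannot divide both
  \<open>3 + 3k\<close> and \<open>3 - 3k\<close>. Hence \<open>z\<close> modulo \<open>n\<close> determines the cycle.\<close>

lemma three_three_cycles: "card {C \<in> cycles 8 G. rim_count True C = 3} \<le> n"
proof -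
  define ts where "ts b = [Fw, Fw, Fw, Sp, b, b, b, Sp]" for b
  define Q where "Q b z = (set (visits (True, z) (ts b)), set (trail (True, z) (ts b)))" for b z
  have tr: "\<exists>z b. b \<noteq> Sp \<and> traces C (True, z) (ts b)"
    if "C \<in> cycles 8 G" "rim_count True C = 3" for C
    using that(1)
  proof (cases rule: cycle_words)
    case (inner z a)
    then show ?thesis using that(2) counts_of_trace[OF inner(2)] inner(1) by simp
  next
    case (four z a b c d)
    then show ?thesis using that(2) counts_of_trace[OF four(5)]
      four(1-4) by simp
  next
    case (two z a b ts')
    have ts': "ts' = [a, a, a, Sp, b, b, b, Sp]"
      using two(4) that(2) counts_of_trace(1)[OF two(3), of True]
      by (elim insertE emptyE) (simp_all add: two(1,2))
    show ?thesis
    proof (cases a)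
      case Fw
      then show ?thesis using two ts' by (auto simp: ts_def)
    next
      case Bw
      have "traces C (True, z) ([Sp, opp b, opp b, opp b, Sp] @ [Fw, Fw, Fw])"
        using traces_opp[OF two(3)] by (simp add: ts' Bw)
      from traces_rotate[OF this] obtain y where "traces C (True, y) [Fw, Fw, Fw, Sp, opp b, opp b, opp b, Sp]"
        using two(2) by (cases b) auto
      then show ?thesis using two(2) by (cases b) (auto simp: ts_def)
    qed (use two in auto)
  qed
  have sign: "int n dvd 3 + sgn_step b * 3 * int k" if "b \<noteq> Sp" "traces C (True, z) (ts b)" for b C z
    using closed_dvd[OF that(2)] that(1) by (simp add: ts_def stride_def algebra_simps)
  have "\<not> (int n dvd 3 + 3 * int k \<and> int n dvd 3 - 3 * int k)"
  proof
    assume "int n dvd 3 + 3 * int k \<and> int n dvd 3 - 3 * int k"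
    then have "int n dvd (3 + 3 * int k) + (3 - 3 * int k)" by (blast intro: dvd_add)
    then show False using not_dvd_small[of 6] n_large by simp
  qed
  then have "b' = b" if "b \<noteq> Sp" "b' \<noteq> Sp" "int n dvd 3 + sgn_step b * 3 * int k"
      "int n dvd 3 + sgn_step b' * 3 * int k" for b b'
    using that by (cases b; cases b') simp_all
  then obtain b where b: "b' = b" if "b' \<noteq> Sp" "int n dvd 3 + sgn_step b' * 3 * int k" for b'
    by metis
  have "{C \<in> cycles 8 G. rim_count True C = 3} \<subseteq> Q b ` {0..<int n}"
  proof
    fix C assume "C \<in> {C \<in> cycles 8 G. rim_count True C = 3}"
    then obtain z b' where z: "b' \<noteq> Sp" "traces C (True, z) (ts b')" using tr by blast
    then have "b' = b" using b sign by blast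
    then have "C = Q b z" using z by (simp add: traces_def Q_def prod_eq_iff)
    also have "vx (True, z) = vx (True, z mod int n)" by (simp add: mod_eq_dvd_iff[symmetric])
    from visits_trail_cong(1,2)[OF this] have "Q b z = Q b (z mod int n)" by (simp only: Q_def)
    finally show "C \<in> Q b ` {0..<int n}" using n_large by simp
  qed
  then have "card {C \<in> cycles 8 G. rim_count True C = 3} \<le> card (Q b ` {0..<int n})"
    by (intro card_mono) auto
  also have "\<dots> \<le> n" using card_image_le[of "{0..<int n}" "Q b"] by simp
  finally show ?thesis .
qed

text \<open>In the prism \<open>G(n,1)\<close> a walk with four spokes has four rim steps \<open>\<plusminus>1\<close> whose sum must
  vanish. Then two cyclically consecutive steps cancel, and the walk closes after four steps.\<close>

lemma prism_cycles:
  assumes "k = 1"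
  shows "\<exists>C \<in> cycles 8 G. rim_count True C = 3"
    and "C \<in> cycles 8 G \<Longrightarrow> spoke_count C \<noteq> 4"
proof -
  define ts where "ts = [Fw, Fw, Fw, Sp, Bw, Bw, Bw, Sp]"
  define Q where "Q = (set (visits (True, 0) ts), set (trail (True, 0) ts))"
  have nd: "\<not> int n dvd 1" "\<not> int n dvd 2" "\<not> int n dvd 3"
    "\<not> int n dvd 4" "\<not> int n dvd -1" "\<not> int n dvd -2" "\<not> int n dvd -3" "\<not> int n dvd -4"
    by (rule not_dvd_small; use n_large in linarith)+
  have stride_1 [simp]: "stride b = 1" for b
    using arg_cong[OF assms, of int] by (simp only: stride_def of_nat_1 if_cancel)
  have dist: "distinct (visits (True, 0) ts)"
    using nd by (simp add: ts_def)
  have "Q \<in> cycles 8 G"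
    unfolding Q_def by (rule traced_cycle) (use dist in \<open>simp_all add: ts_def\<close>)
  moreover have "traces Q (True, 0) ts"
    using dist by (simp add: traces_def Q_def) (simp add: ts_def)
  then have "rim_count True Q = 3" by (simp add: counts_of_trace ts_def)
  ultimately show "\<exists>C \<in> cycles 8 G. rim_count True C = 3" by blast
  show "spoke_count C \<noteq> 4" if "C \<in> cycles 8 G"
    using that
  proof (cases rule: cycle_words)
    case (inner z a)
    then show ?thesis using counts_of_trace(2)[OF inner(2)] by simp
  next
    case (two z a b ts)
    then show ?thesis using counts_of_trace(2)[OF two(3)] by auto
  next
    case (four z a b c d)
    then show ?thesis using nd
      by (cases a; cases b; cases c; cases d) (simp_all add: traces_def)
  qed
qed

section \<open>Comparing the three orbits\<close>

lemma sum_counts: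
  "(\<Sum>C\<in>cycles 8 G. rim_count b C) = n * sigma G (rim b 0)"
  "(\<Sum>C\<in>cycles 8 G. spoke_count C) = n * sigma G (spoke 0)"
proof -
  have fin: "finite (range (rim b))" "finite (range spoke)"
    using card_rims card_spokes n_large by (auto intro: card_ge_0_finite)
  show "(\<Sum>C\<in>cycles 8 G. rim_count b C) = n * sigma G (rim b 0)"
  proof -
    have "(\<Sum>e\<in>range (rim b). sigma G e) = (\<Sum>e\<in>range (rim b). sigma G (rim b 0))"
      using sigma_rotation(1) by (intro sum.cong) blast+
    then show ?thesis using sum_sigma[OF finite_cycles_G fin(1)] by (simp add: rim_count_def card_rims)
  qed
  show "(\<Sum>C\<in>cycles 8 G. spoke_count C) = n * sigma G (spoke 0)"
  proof -
    have "(\<Sum>e\<in>range spoke. sigma G e) = (\<Sum>e\<in>range spoke. sigma G (spoke 0))"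
      using sigma_rotation(2) by (intro sum.cong) blast+
    then show ?thesis using sum_sigma[OF finite_cycles_G fin(2)] by (simp add: spoke_count_def card_spokes)
  qed
qed

lemma sigma_not_constant:
  "\<not> (sigma G (rim True 0) = sigma G (rim False 0) \<and> sigma G (rim True 0) = sigma G (spoke 0))"
proof
  let ?Y = "cycles 8 G"
  assume "sigma G (rim True 0) = sigma G (rim False 0) \<and> sigma G (rim True 0) = sigma G (spoke 0)"
  then have rims_eq: "sum (rim_count True) ?Y = sum (rim_count False) ?Y"
    and spokes_eq: "sum (rim_count True) ?Y = sum spoke_count ?Y" by (simp_all add: sum_counts)
  have balanced: "rim_count True C = rim_count False C" if C: "C \<in> ?Y" for C
  proof (rule ccontr)
    assume "rim_count True C \<noteq> rim_count False C"
    then obtain b where b: "rim_count b C < rim_count (\<not> b) C" by (metis linorder_neqE_nat)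
    have "sum (rim_count b) ?Y < sum (rim_count (\<not> b)) ?Y"
      using same_bias[OF C _ b] b C by (intro sum_strict_mono_ex1 finite_cycles_G) auto
    then show False using rims_eq by (cases b) auto
  qed
  define A where "A = {C \<in> ?Y. rim_count True C = 3}"
  define B where "B = {C \<in> ?Y. spoke_count C = 4}"
  have A: "rim_count True C = 3 \<and> spoke_count C = 2" if "C \<in> A" for C
    using that balanced[of C] by (auto simp: A_def elim!: cycle_types)
  have B: "rim_count True C = 2 \<and> spoke_count C = 4" if "C \<in> B" for C
    using that by (auto simp: B_def elim!: cycle_types)
  \<comment> \<open>The balanced types are exactly \<open>(3,2,3)\<close> and \<open>(2,4,2)\<close>.\<close>
  have AB: "?Y = A \<union> B"
  proof (intro set_eqI iffI)
    fix C assume "C \<in> ?Y"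
    then show "C \<in> A \<union> B" using balanced[of C] by (auto simp: A_def B_def elim: cycle_types)
  qed (auto simp: A_def B_def)
  have disj: "A \<inter> B = {}" using A B by fastforce
  have fin: "finite A" "finite B" using finite_cycles_G by (auto simp: A_def B_def)
  have "sum (rim_count True) ?Y = 3 * card A + 2 * card B" "sum spoke_count ?Y = 2 * card A + 4 * card B"
    unfolding AB using A B by (simp_all add: sum.union_disjoint[OF fin disj])
  then have "card A = 2 * card B" using spokes_eq by simp
  moreover have "card A > 0 \<and> card B = 0" if "k = 1"
    using prism_cycles[OF that] fin by (auto simp: A_def B_def card_gt_0_iff)
  moreover have "card A \<le> n" "1 < k \<Longrightarrow> n \<le> card B"
    using three_three_cycles four_spoke_cycles by (simp_all add: A_def B_def)
  ultimately show False using k_pos n_large by (cases "k = 1") auto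
qed

lemma orbit_is_part:
  assumes "X = {e \<in> edges G. sigma G e = s}" "X \<noteq> {}"
  shows "X \<in> edge_partition G"
proof -
  obtain e where "e \<in> X" using assms(2) by blast
  then have e: "e \<in> edges G" "X = {(e, e'). e \<in> edges G \<and> e' \<in> edges G \<and> sigma G e = sigma G e'} `` {e}"
    using assms(1) by auto
  show ?thesis unfolding edge_partition_def e(2) by (rule quotientI[OF e(1)])
qed

lemma part_of_size_n: "\<exists>P \<in> edge_partition G. card P = n"
proof -
  let ?s = "sigma G"
  have part: "\<exists>P \<in> edge_partition G. card P = n" if "{e \<in> edges G. ?s e = s} = range f" "card (range f) = n"
    for s and f :: "int \<Rightarrow> gp_vertex set"
    using orbit_is_part[of "range f" s] that by auto
  have orbit: "{e \<in> range f. ?s e = s} = (if ?s (f 0) = s then range f else {})"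
    if const: "\<And>z. ?s (f z) = ?s (f 0)" for s and f :: "int \<Rightarrow> gp_vertex set"
  proof -
    have "?s e = ?s (f 0)" if "e \<in> range f" for e using that const by blast
    then have "{e \<in> range f. ?s e = s} = {e \<in> range f. ?s (f 0) = s}"
      by (intro Collect_cong) metis
    then show ?thesis by simp
  qed
  have "{e \<in> edges G. ?s e = s} = {e \<in> range (rim True). ?s e = s} \<union>
      {e \<in> range (rim False). ?s e = s} \<union> {e \<in> range spoke. ?s e = s}" for s
    unfolding edges_G by blast
  then have level: "{e \<in> edges G. ?s e = s} =
      (if ?s (rim True 0) = s then range (rim True) else {}) \<union>
      (if ?s (rim False 0) = s then range (rim False) else {}) \<union>
      (if ?s (spoke 0) = s then range spoke else {})" for s
    using orbit[of "rim True", OF sigma_rotation(1)] orbit[of "rim False", OF sigma_rotation(1)]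
      orbit[of spoke, OF sigma_rotation(2)] by simp
  consider "?s (rim True 0) \<noteq> ?s (rim False 0)" "?s (rim True 0) \<noteq> ?s (spoke 0)"
    | "?s (rim False 0) \<noteq> ?s (rim True 0)" "?s (rim False 0) \<noteq> ?s (spoke 0)"
    | "?s (spoke 0) \<noteq> ?s (rim True 0)" "?s (spoke 0) \<noteq> ?s (rim False 0)"
    using sigma_not_constant by metis
  then show ?thesis
  proof cases
    case 1 then show ?thesis using part[OF _ card_rims] level[of "?s (rim True 0)"] by simp
  next
    case 2 then show ?thesis using part[OF _ card_rims] level[of "?s (rim False 0)"] by simp
  next
    case 3 then show ?thesis using part[OF _ card_spokes] level[of "?s (spoke 0)"] by simp
  qed
qed

end

theorem lemma1:
  fixes n k :: nat
  assumes "1 \<le> k" and "2 * k < n"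
    and "card (verts (gen_petersen n k)) > 80"
  shows "\<exists>P \<in> edge_partition (gen_petersen n k). card P = n"
proof -
  have "verts (gen_petersen n k) = U ` {..<n} \<union> W ` {..<n}" by (simp add: gen_petersen_def)
  then have "card (verts (gen_petersen n k)) \<le> n + n"
    by (metis card_Un_le card_image_le card_lessThan add_le_mono finite_lessThan le_trans)
  then interpret large_petersen n k using assms by unfold_locales auto
  show ?thesis by (rule part_of_size_n)
qed

end
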